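(* Let $n \ge 2$ and let $f \colon \mathbb{R}^n \to \mathbb{R}$ be a nonconstant polynomial. The following conditions are equivalent: (i) $\mathcal{Z}(f)$ is stably compact. (ii) $f|_{\mathbb{R}^J} \not\equiv 0$ for all nonempty $J \subseteq \{1,\ldots,n\}$, and for every $\Delta \in \Gamma_{\infty}(f)$ one has $f_{\Delta}(x) \neq 0$ for all $x \in (\mathbb{R}\setminus\{0\})^n$. (iii) $f|_{\mathbb{R}^J} \not\equiv 0$ for all nonempty $J \subseteq \{1,\ldots,n\}$, and one of the following statements holds: (iii1) $f_{\Delta} > 0$ on $(\mathbb{R}\setminus\{0\})^n$ for all $\Delta \in \Gamma_{\infty}(f)$; (iii2) $f_{\Delta} < 0$ on $(\mathbb{R}\setminus\{0\})^n$ for all $\Delta \in \Gamma_{\infty}(f)$. (iv) $f|_{\mathbb{R}^J} \not\equiv 0$ for all nonempty $J \subseteq \{1,\ldots,n\}$, and there exist $\sigma \in \{-1,1\}$ and constants $c_1 > 0$, $c_2 > 0$, $R > 0$ such that $$c_1 \mathscr{P}(x) \le \sigma f(x) \le c_2 \mathscr{P}(x) \quad \text{for all } \|x\| > R.$$ (v) $f|_{\mathbb{R}^J} \not\equiv 0$ for all nonempty $J \subseteq \{1,\ldots,n\}$, $f$ is non-degenerate at infinity, and there exist $\sigma \in \{-1,1\}$ and $R > 0$ such that $\sigma f(x) \ge 0$ for all $\|x\| > R$.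
   Context: $\mathcal{Z}(f) := \{x \in \mathbb{R}^n \mid f(x) = 0\}$ is the zero set of $f$. For $J \subseteq \{1,\ldots,n\}$, $\mathbb{R}^J := \{x \in \mathbb{R}^n \mid x_j = 0 \text{ for all } j \notin J\}$. For a polynomial $h = \sum_{\alpha} a_\alpha x^\alpha$ with $\alpha \in \mathbb{Z}_+^n$ (tuples of non-negative integers) and $x^\alpha = x_1^{\alpha_1}\cdots x_n^{\alpha_n}$, the norm is $\|h\| := \max_\alpha |a_\alpha|$, and the Newton polyhedron $\Gamma(h)$ is the convex hull in $\mathbb{R}^n$ of $\{\alpha \mid a_\alpha \neq 0\}$ (the origin is not added; $\Gamma(0)=\emptyset$). For nonzero $q \in \mathbb{R}^n$ let $d(q,\Gamma(f)) := \min\{\langle q,\alpha\rangle \mid \alpha \in \Gamma(f)\}$ and $\Delta(q,\Gamma(f)) := \{\alpha \in \Gamma(f) \mid \langle q,\alpha\rangle = d(q,\Gamma(f))\}$, which is a face of $\Gamma(f)$. The Newton boundary at infinity $\Gamma_\infty(f)$ consists of all faces $\Delta(q,\Gamma(f))$ with $q \in \mathbb{R}^n$ and $\min_{j=1,\ldots,n} q_j < 0$; "$\Delta \in \Gamma_\infty(f)$" means that $\Delta$ is one of these faces. For a face $\Delta$ of $\Gamma(f)$, with $f = \sum_\alpha a_\alpha x^\alpha$, $f_\Delta := \sum_{\alpha \in \Delta} a_\alpha x^\alpha$. $f$ is non-degenerate (at infinity) if for each $\Delta \in \Gamma_\infty(f)$ the system $f_\Delta(x) = \frac{\partial f_\Delta}{\partial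 x_1}(x) = \cdots = \frac{\partial f_\Delta}{\partial x_n}(x) = 0$ has no solution in $(\mathbb{R}\setminus\{0\})^n$. $\mathscr{P}(x) := \sum_{\alpha \in \Gamma(f) \cap \mathbb{Z}_+^n} |x^\alpha|$. $\mathcal{Z}(f)$ is called stably compact if there is $\epsilon > 0$ such that $\mathcal{Z}(f+g)$ is compact for all polynomials $g \colon \mathbb{R}^n \to \mathbb{R}$ with $\Gamma(g) \subseteq \Gamma(f)$ and $\|g\| < \epsilon$. For points $x\in\mathbb{R}^n$, $\|x\|$ is the Euclidean norm. *)

theory Defs
  imports "HOL-Analysis.Analysis" "HOL-Library.Poly_Mapping"
begin

text \<open>
  The coordinates of real n-space are indexed by a finite type \<open>'n\<close>, so that \<open>CARD('n) = n\<close>.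
  A polynomial is the finitely supported family of its coefficients, indexed by exponent tuples;
  \<open>keys f\<close> is its set of exponents. Over the reals, distinct families give distinct polynomial
  functions.
\<close>

type_synonym 'n mpoly = "(nat ^ 'n) \<Rightarrow>\<^sub>0 real"

definition monom_eval :: "nat ^ 'n \<Rightarrow> real ^ 'n \<Rightarrow> real" where
  "monom_eval \<alpha> x = (\<Prod>j\<in>UNIV. (x $ j) ^ (\<alpha> $ j))"

definition peval :: "'n::finite mpoly \<Rightarrow> real ^ 'n \<Rightarrow> real" where
  "peval f x = (\<Sum>\<alpha>\<in>Poly_Mapping.keys f. Poly_Mapping.lookup f \<alpha> * monom_eval \<alpha> x)"

definition partial_deriv :: "'n::finite mpoly \<Rightarrow> 'n \<Rightarrow> real ^ 'n \<Rightarrow> real" where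
  "partial_deriv f j x = deriv (\<lambda>t. peval f (\<chi> i. if i = j then t else x $ i)) (x $ j)"

definition zero_set :: "'n::finite mpoly \<Rightarrow> (real ^ 'n) set" where
  "zero_set f = {x. peval f x = 0}"

definition coord_subspace :: "'n set \<Rightarrow> (real ^ 'n) set" where
  "coord_subspace J = {x. \<forall>j. j \<notin> J \<longrightarrow> x $ j = 0}"

definition real_torus :: "(real ^ 'n) set" where
  "real_torus = {x. \<forall>j. x $ j \<noteq> 0}"

definition coeff_norm :: "'n::finite mpoly \<Rightarrow> real" where
  "coeff_norm f = Max (range (\<lambda>\<alpha>. \<bar>Poly_Mapping.lookup f \<alpha>\<bar>))"

text \<open>The range is finite, because only finitely many coefficients are nonzero.\<close>

lemma finite_range_coeff: "finite (range (\<lambda>\<alpha>. \<bar>Poly_Mapping.lookup f \<alpha>\<bar> :: real))"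
proof -
  have "range (\<lambda>\<alpha>. \<bar>Poly_Mapping.lookup f \<alpha>\<bar>)
      \<subseteq> insert 0 ((\<lambda>\<alpha>. \<bar>Poly_Mapping.lookup f \<alpha>\<bar>) ` Poly_Mapping.keys f)"
    by (auto simp: in_keys_iff)
  then show ?thesis
    by (rule finite_subset) simp
qed

definition exponent_vec :: "nat ^ 'n \<Rightarrow> real ^ 'n" where
  "exponent_vec \<alpha> = (\<chi> j. real (\<alpha> $ j))"

definition newton_polyhedron :: "'n::finite mpoly \<Rightarrow> (real ^ 'n) set" where
  "newton_polyhedron f = convex hull (exponent_vec ` Poly_Mapping.keys f)"

text \<open>The minimum exists for every nonempty Newton polyhedron, by compactness.\<close>

definition face_dist :: "real ^ 'n \<Rightarrow> (real ^ 'n) set \<Rightarrow> real" where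
  "face_dist q P = (LEAST t. t \<in> (\<lambda>\<alpha>. q \<bullet> \<alpha>) ` P)"

definition face :: "real ^ 'n \<Rightarrow> (real ^ 'n) set \<Rightarrow> (real ^ 'n) set" where
  "face q P = {\<alpha> \<in> P. q \<bullet> \<alpha> = face_dist q P}"

definition newton_boundary_infinity :: "'n::finite mpoly \<Rightarrow> (real ^ 'n) set set" where
  "newton_boundary_infinity f =
     {face q (newton_polyhedron f) | q. Min (range (\<lambda>j. q $ j)) < 0}"

definition face_part :: "'n::finite mpoly \<Rightarrow> (real ^ 'n) set \<Rightarrow> 'n mpoly" where
  "face_part f \<Delta> = (\<Sum>\<alpha> | \<alpha> \<in> Poly_Mapping.keys f \<and> exponent_vec \<alpha> \<in> \<Delta>.
     Poly_Mapping.single \<alpha> (Poly_Mapping.lookup f \<alpha>))"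

definition nondegenerate_at_infinity :: "'n::finite mpoly \<Rightarrow> bool" where
  "nondegenerate_at_infinity f \<longleftrightarrow>
     (\<forall>\<Delta>\<in>newton_boundary_infinity f.
        \<not> (\<exists>x\<in>real_torus. peval (face_part f \<Delta>) x = 0 \<and>
              (\<forall>j. partial_deriv (face_part f \<Delta>) j x = 0)))"

definition newton_lattice_points :: "'n::finite mpoly \<Rightarrow> (nat ^ 'n) set" where
  "newton_lattice_points f = {\<alpha>. exponent_vec \<alpha> \<in> newton_polyhedron f}"

definition newton_majorant :: "'n::finite mpoly \<Rightarrow> real ^ 'n \<Rightarrow> real" where
  "newton_majorant f x = (\<Sum>\<alpha>\<in>newton_lattice_points f. \<bar>monom_eval \<alpha> x\<bar>)"

text \<open>The sum in \<open>newton_majorant\<close> is over a finite set.\<close>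

lemma finite_newton_lattice_points: "finite (newton_lattice_points f)"
proof -
  have "bounded (newton_polyhedron f)"
    by (simp add: newton_polyhedron_def finite_imp_bounded bounded_convex_hull)
  then obtain B where B: "\<And>x. x \<in> newton_polyhedron f \<Longrightarrow> norm x \<le> B"
    by (auto simp: bounded_iff)
  have "newton_lattice_points f \<subseteq> vec_lambda ` (\<Pi>\<^sub>E j\<in>UNIV. {..nat \<lceil>B\<rceil>})"
  proof (rule subsetI)
    fix \<alpha>
    assume "\<alpha> \<in> newton_lattice_points f"
    then have *: "norm (exponent_vec \<alpha>) \<le> B"
      by (simp add: newton_lattice_points_def B)
    have "\<alpha> $ j \<le> nat \<lceil>B\<rceil>" for j
    proof -
      have "\<bar>exponent_vec \<alpha> $ j\<bar> \<le> norm (exponent_vec \<alpha>)"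
        by (rule component_le_norm_cart)
      with * have "real (\<alpha> $ j) \<le> B"
        by (simp add: exponent_vec_def)
      then show ?thesis
        by linarith
    qed
    then have "vec_nth \<alpha> \<in> (\<Pi>\<^sub>E j\<in>UNIV. {..nat \<lceil>B\<rceil>})"
      by auto
    then show "\<alpha> \<in> vec_lambda ` (\<Pi>\<^sub>E j\<in>UNIV. {..nat \<lceil>B\<rceil>})"
      by (metis image_eqI vec_nth_inverse)
  qed
  moreover have "finite (\<Pi>\<^sub>E j\<in>(UNIV :: 'a set). {..nat \<lceil>B\<rceil>})"
    by (intro finite_PiE) auto
  ultimately show ?thesis
    by (blast intro: finite_subset)
qed

definition stably_compact_zero_set :: "'n::finite mpoly \<Rightarrow> bool" where
  "stably_compact_zero_set f \<longleftrightarrow>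
     (\<exists>\<epsilon>>0. \<forall>g. newton_polyhedron g \<subseteq> newton_polyhedron f \<and> coeff_norm g < \<epsilon> \<longrightarrow>
        compact (zero_set (f + g)))"

definition nonvanishing_on_coord_subspaces :: "'n::finite mpoly \<Rightarrow> bool" where
  "nonvanishing_on_coord_subspaces f \<longleftrightarrow>
     (\<forall>J. J \<noteq> {} \<longrightarrow> \<not> (\<forall>x\<in>coord_subspace J. peval f x = 0))"

end

theory Submission
  imports Defs
begin

text \<open>
  Along the curve \<open>s \<mapsto> (x\<^sub>j exp (- s q\<^sub>j))\<^sub>j\<close> the polynomial \<open>f\<close> is asymptotic to its part on
  the face selected by \<open>q\<close>, and the curve escapes to infinity when some \<open>q\<^sub>j < 0\<close>.

  If a face part vanishes at \<open>x\<close>, perturb \<open>f\<close> by \<open>\<plusminus> \<delta> x\<^sup>\<alpha>\<close> with a nonzero exponent \<open>\<alpha>\<close> on that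
  face. The two perturbations have opposite signs along the curve, but they agree on a coordinate
  axis where \<open>x\<^sup>\<alpha> = 0\<close>; since the complement of a ball is connected, they cannot both have bounded
  zero sets.

  If conversely \<open>\<bar>f\<bar>\<close> is not bounded below by a multiple of the majorant, take a sequence
  of torus points violating the bound, in logarithmic coordinates \<open>u\<^sub>k = - ln \<bar>x\<^sub>k\<bar>\<close>. After passing to a
  subsequence let \<open>S\<close> be the exponents whose monomials are of maximal order. Modulo a bounded error,
  \<open>u\<^sub>k\<close> can be replaced by \<open>w\<^sub>k\<close> orthogonal to all differences of elements of \<open>S\<close>; then \<open>S\<close> is
  exactly the face selected by \<open>w\<^sub>k\<close> for large \<open>k\<close>, and a limit of the rescaled points is a zero
  of the corresponding face part.
\<close>

section \<open>Monomials, polynomial evaluation and continuity\<close>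

lemma monom_eval_0 [simp]: "monom_eval 0 x = 1"
  by (simp add: monom_eval_def)

lemma monom_eval_eq_0_iff: "monom_eval \<alpha> x = 0 \<longleftrightarrow> (\<exists>j. \<alpha> $ j > 0 \<and> x $ j = 0)"
  by (auto simp: monom_eval_def)

lemma monom_eval_torus: "x \<in> real_torus \<Longrightarrow> monom_eval \<alpha> x \<noteq> 0"
  by (auto simp: monom_eval_eq_0_iff real_torus_def)

lemma continuous_on_monom_eval [continuous_intros]:
  "continuous_on S g \<Longrightarrow> continuous_on S (\<lambda>x. monom_eval \<alpha> (g x))"
  unfolding monom_eval_def by (intro continuous_intros)

lemma tendsto_monom_eval [tendsto_intros]:
  "(g \<longlongrightarrow> y) F \<Longrightarrow> ((\<lambda>x. monom_eval \<alpha> (g x)) \<longlongrightarrow> monom_eval \<alpha> y) F"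
  unfolding monom_eval_def by (intro tendsto_intros)

lemma continuous_on_peval [continuous_intros]:
  "continuous_on S g \<Longrightarrow> continuous_on S (\<lambda>x. peval f (g x))"
  unfolding peval_def by (intro continuous_intros)

lemma continuous_on_newton_majorant [continuous_intros]:
  "continuous_on S g \<Longrightarrow> continuous_on S (\<lambda>x. newton_majorant f (g x))"
  unfolding newton_majorant_def by (intro continuous_intros)

lemma peval_superset:
  "finite A \<Longrightarrow> Poly_Mapping.keys f \<subseteq> A \<Longrightarrow> peval f x = (\<Sum>\<alpha>\<in>A. Poly_Mapping.lookup f \<alpha> * monom_eval \<alpha> x)"
  unfolding peval_def by (rule sum.mono_neutral_left) (auto simp: in_keys_iff)

lemma peval_add: "peval (f + g) x = peval f x + peval g x"
proof -
  let ?A = "Poly_Mapping.keys f \<union> Poly_Mapping.keys g"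
  have "Poly_Mapping.keys (f + g) \<subseteq> ?A" by (rule Poly_Mapping.keys_add)
  then show ?thesis
    by (simp add: peval_superset[of ?A] lookup_add distrib_right sum.distrib)
qed

lemma peval_single: "peval (Poly_Mapping.single \<alpha> c) x = c * monom_eval \<alpha> x"
  by (subst peval_superset[of "{\<alpha>}"]) auto

lemma closed_zero_set: "closed (zero_set f)"
proof -
  have "zero_set f = peval f -` {0}" by (auto simp: zero_set_def)
  moreover have "continuous_on UNIV (peval f)"
    using continuous_on_peval[OF continuous_on_id, of UNIV f] by simp
  ultimately show ?thesis
    by (simp add: closed_vimage)
qed

section \<open>Newton polyhedra, minimal values of linear forms, and face parts\<close>

lemma newton_lattice_keys: "Poly_Mapping.keys f \<subseteq> newton_lattice_points f"
  by (auto simp: newton_lattice_points_def newton_polyhedron_def intro: hull_inc)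

text \<open>Half-spaces are convex, so an inequality checked on exponents extends to the hull. This
  serves both for the minimum of a linear form and, later, for all lattice points entering the
  majorant.\<close>

lemma newton_polyhedron_lower_bound:
  assumes "\<And>\<alpha>. \<alpha> \<in> Poly_Mapping.keys f \<Longrightarrow> d \<le> q \<bullet> exponent_vec \<alpha>" and "p \<in> newton_polyhedron f"
  shows "d \<le> q \<bullet> p"
proof -
  have "newton_polyhedron f \<subseteq> {p. q \<bullet> p \<ge> d}"
    unfolding newton_polyhedron_def
    by (rule hull_minimal) (use assms(1) in \<open>auto intro: convex_halfspace_ge\<close>)
  with assms(2) show ?thesis by auto
qed

lemma face_dist_newton_polyhedron:
  assumes "\<alpha> \<in> Poly_Mapping.keys f"
    and "\<And>\<beta>. \<beta> \<in> Poly_Mapping.keys f \<Longrightarrow> q \<bullet> exponent_vec \<alpha> \<le> q \<bullet> exponent_vec \<beta>"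
  shows "face_dist q (newton_polyhedron f) = q \<bullet> exponent_vec \<alpha>"
  unfolding face_dist_def
proof (rule Least_equality)
  show "q \<bullet> exponent_vec \<alpha> \<in> (\<bullet>) q ` newton_polyhedron f"
    using assms(1) by (auto simp: newton_polyhedron_def intro: hull_inc)
qed (use newton_polyhedron_lower_bound[OF assms(2)] in auto)

lemma face_dist_attained:
  assumes "f \<noteq> 0"
  obtains \<alpha> where "\<alpha> \<in> Poly_Mapping.keys f" "face_dist q (newton_polyhedron f) = q \<bullet> exponent_vec \<alpha>"
    "\<And>\<beta>. \<beta> \<in> Poly_Mapping.keys f \<Longrightarrow> face_dist q (newton_polyhedron f) \<le> q \<bullet> exponent_vec \<beta>"
proof -
  have "Poly_Mapping.keys f \<noteq> {}" using assms by simp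
  then obtain \<alpha> where "\<alpha> \<in> Poly_Mapping.keys f"
    "\<forall>\<beta>\<in>Poly_Mapping.keys f. q \<bullet> exponent_vec \<alpha> \<le> q \<bullet> exponent_vec \<beta>"
    using arg_min_if_finite(1)[of "Poly_Mapping.keys f" "\<lambda>\<alpha>. q \<bullet> exponent_vec \<alpha>"]
      arg_min_least[of "Poly_Mapping.keys f" _ "\<lambda>\<alpha>. q \<bullet> exponent_vec \<alpha>"] finite_keys by metis
  then show ?thesis
    using face_dist_newton_polyhedron[of \<alpha> f q] by (intro that[of \<alpha>]) auto
qed

lemma lookup_face_part:
  "Poly_Mapping.lookup (face_part f \<Delta>) \<alpha> = (if exponent_vec \<alpha> \<in> \<Delta> then Poly_Mapping.lookup f \<alpha> else 0)"
  by (auto simp: face_part_def lookup_sum lookup_single when_def in_keys_iff)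

text \<open>Every exponent of \<open>f\<close> lies in the hull already, so membership in the face
  reduces to one linear equation on exponents. Face parts are evaluated in this form below.\<close>

lemma peval_face_part:
  assumes "f \<noteq> 0"
  shows "peval (face_part f (face q (newton_polyhedron f))) x =
    (\<Sum>\<alpha> | \<alpha> \<in> Poly_Mapping.keys f \<and> q \<bullet> exponent_vec \<alpha> = face_dist q (newton_polyhedron f).
        Poly_Mapping.lookup f \<alpha> * monom_eval \<alpha> x)"
proof -
  let ?g = "face_part f (face q (newton_polyhedron f))"
  let ?S = "{\<alpha>. \<alpha> \<in> Poly_Mapping.keys f \<and> q \<bullet> exponent_vec \<alpha> = face_dist q (newton_polyhedron f)}"
  have hull: "exponent_vec \<alpha> \<in> newton_polyhedron f" if "\<alpha> \<in> Poly_Mapping.keys f" for \<alpha>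
    using that by (auto simp: newton_polyhedron_def intro: hull_inc)
  have "Poly_Mapping.keys ?g \<subseteq> ?S"
    by (auto simp: in_keys_iff lookup_face_part face_def split: if_splits)
  then have "peval ?g x = (\<Sum>\<alpha>\<in>?S. Poly_Mapping.lookup ?g \<alpha> * monom_eval \<alpha> x)"
    by (intro peval_superset) auto
  also have "\<dots> = (\<Sum>\<alpha>\<in>?S. Poly_Mapping.lookup f \<alpha> * monom_eval \<alpha> x)"
    by (intro sum.cong) (auto simp: lookup_face_part face_def hull)
  finally show ?thesis .
qed

section \<open>Asymptotics of a polynomial along exponential curves\<close>

text \<open>In the coordinates -ln |x_j| this is translation by \<open>w\<close>. The minus sign
  makes the exponents minimising \<open>w\<close> dominate, in accordance with faces being defined
  by minima.\<close>

definition dilate :: "real ^ 'n \<Rightarrow> real ^ 'n \<Rightarrow> real ^ 'n" where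
  "dilate w x = (\<chi> j. x $ j * exp (- w $ j))"

lemma monom_eval_dilate:
  "monom_eval \<alpha> (dilate w x) = monom_eval \<alpha> x * exp (- (w \<bullet> exponent_vec \<alpha>))"
proof -
  have "w \<bullet> exponent_vec \<alpha> = (\<Sum>j\<in>UNIV. real (\<alpha> $ j) * w $ j)"
    by (simp add: inner_vec_def exponent_vec_def mult.commute)
  then show ?thesis
    by (simp add: monom_eval_def dilate_def power_mult_distrib prod.distrib exp_of_nat_mult [symmetric]
        exp_sum sum_negf [symmetric] del: mult_minus_right)
qed

text \<open>After rescaling, the monomial of \<alpha> carries the factor exp(-s (q \<bullet>
  \<alpha> - d)), where d is the minimum: it equals 1 on the face and decays off it.\<close>

lemma peval_dilate_tendsto:
  assumes "f \<noteq> 0"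
  shows "((\<lambda>s. peval f (dilate (s *\<^sub>R q) x) * exp (s * face_dist q (newton_polyhedron f)))
    \<longlongrightarrow> peval (face_part f (face q (newton_polyhedron f))) x) at_top"
proof -
  define d where "d = face_dist q (newton_polyhedron f)"
  have d: "d \<le> q \<bullet> exponent_vec \<alpha>" if "\<alpha> \<in> Poly_Mapping.keys f" for \<alpha>
    using face_dist_attained[OF assms, of q] that unfolding d_def by metis
  have "((\<lambda>s. \<Sum>\<alpha>\<in>Poly_Mapping.keys f. Poly_Mapping.lookup f \<alpha> * monom_eval \<alpha> x * exp (- (s * (q \<bullet> exponent_vec \<alpha> - d))))
     \<longlongrightarrow> (\<Sum>\<alpha>\<in>Poly_Mapping.keys f. Poly_Mapping.lookup f \<alpha> * monom_eval \<alpha> x * (if q \<bullet> exponent_vec \<alpha> = d then 1 else 0))) at_top"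
  proof (intro tendsto_intros)
    fix \<alpha> assume a: "\<alpha> \<in> Poly_Mapping.keys f"
    show "((\<lambda>s. exp (- (s * (q \<bullet> exponent_vec \<alpha> - d)))) \<longlongrightarrow>
      (if q \<bullet> exponent_vec \<alpha> = d then 1 else 0)) at_top"
    proof (cases "q \<bullet> exponent_vec \<alpha> = d")
      case False
      then have "q \<bullet> exponent_vec \<alpha> - d > 0" using d[OF a] by simp
      then have "filterlim (\<lambda>s. s * (q \<bullet> exponent_vec \<alpha> - d)) at_top at_top"
        by (intro filterlim_at_top_mult_tendsto_pos[OF tendsto_const] filterlim_ident)
      then have "filterlim (\<lambda>s. - (s * (q \<bullet> exponent_vec \<alpha> - d))) at_bot at_top"
        by (simp add: filterlim_uminus_at_bot)
      from filterlim_compose[OF exp_at_bot this] False show ?thesis by simp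
    qed simp
  qed
  moreover have "peval f (dilate (s *\<^sub>R q) x) * exp (s * d) =
     (\<Sum>\<alpha>\<in>Poly_Mapping.keys f. Poly_Mapping.lookup f \<alpha> * monom_eval \<alpha> x * exp (- (s * (q \<bullet> exponent_vec \<alpha> - d))))" for s
    unfolding peval_def monom_eval_dilate sum_distrib_right
    by (intro sum.cong refl) (simp add: exp_diff exp_minus right_diff_distrib field_simps)
  moreover have "(\<Sum>\<alpha>\<in>Poly_Mapping.keys f. Poly_Mapping.lookup f \<alpha> * monom_eval \<alpha> x * (if q \<bullet> exponent_vec \<alpha> = d then 1 else 0))
     = peval (face_part f (face q (newton_polyhedron f))) x"
    unfolding peval_face_part[OF assms] d_def [symmetric]
    by (rule sum.mono_neutral_cong_right) auto
  ultimately show ?thesis by (simp add: d_def)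
qed

lemma norm_dilate_at_top:
  assumes "x \<in> real_torus" and "q $ j < 0"
  shows "filterlim (\<lambda>s. norm (dilate (s *\<^sub>R q) x)) at_top at_top"
proof (rule filterlim_at_top_mono)
  have "filterlim (\<lambda>s. s * (- q $ j)) at_top at_top"
    by (intro filterlim_at_top_mult_tendsto_pos[OF tendsto_const] filterlim_ident) (use assms in auto)
  then have "filterlim (\<lambda>s. exp (s * (- q $ j))) at_top at_top"
    by (rule filterlim_compose[OF exp_at_top])
  then show "filterlim (\<lambda>s. exp (s * (- q $ j)) * \<bar>x $ j\<bar>) at_top at_top"
    by (intro filterlim_at_top_mult_tendsto_pos[OF tendsto_const])
      (use assms(1) in \<open>auto simp: real_torus_def\<close>)
  show "\<forall>\<^sub>F s in at_top. exp (s * (- q $ j)) * \<bar>x $ j\<bar> \<le> norm (dilate (s *\<^sub>R q) x)"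
  proof (rule always_eventually, rule allI)
    fix s
    show "exp (s * (- q $ j)) * \<bar>x $ j\<bar> \<le> norm (dilate (s *\<^sub>R q) x)"
      using component_le_norm_cart[of "dilate (s *\<^sub>R q) x" j]
      by (simp add: dilate_def abs_mult mult.commute)
  qed
qed

lemma newton_boundary_infinityE:
  assumes "\<Delta> \<in> newton_boundary_infinity f"
  obtains q j where "\<Delta> = face q (newton_polyhedron f)" "q $ j < 0"
  using assms by (auto simp: newton_boundary_infinity_def Min_less_iff)

lemma newton_boundary_infinityI:
  "q $ j < 0 \<Longrightarrow> face q (newton_polyhedron f) \<in> newton_boundary_infinity f"
  by (auto simp: newton_boundary_infinity_def Min_less_iff)

text \<open>A sign known only far from the origin passes to the face part at every torus point,
  because the curve through that point escapes to infinity and the rescaling factor is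
  positive.\<close>

lemma face_part_nonneg:
  assumes "f \<noteq> 0" and nonneg: "\<And>x. norm x > R \<Longrightarrow> 0 \<le> \<sigma> * peval f x"
    and "\<Delta> \<in> newton_boundary_infinity f" and x: "x \<in> real_torus"
  shows "0 \<le> \<sigma> * peval (face_part f \<Delta>) x"
proof -
  obtain q j where q: "\<Delta> = face q (newton_polyhedron f)" "q $ j < 0"
    using assms(3) by (rule newton_boundary_infinityE)
  have "((\<lambda>s. \<sigma> * (peval f (dilate (s *\<^sub>R q) x) * exp (s * face_dist q (newton_polyhedron f))))
    \<longlongrightarrow> \<sigma> * peval (face_part f \<Delta>) x) at_top"
    unfolding q by (intro tendsto_intros peval_dilate_tendsto assms)
  moreover have "\<forall>\<^sub>F s in at_top. norm (dilate (s *\<^sub>R q) x) > R"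
    using norm_dilate_at_top[OF x q(2)] by (simp add: filterlim_at_top_dense)
  then have "\<forall>\<^sub>F s in at_top.
      0 \<le> \<sigma> * (peval f (dilate (s *\<^sub>R q) x) * exp (s * face_dist q (newton_polyhedron f)))"
  proof eventually_elim
    case (elim s)
    from mult_nonneg_nonneg[OF nonneg[OF elim] exp_ge_zero] show ?case
      by (simp add: mult.assoc)
  qed
  ultimately show ?thesis
    by (rule tendsto_lowerbound) simp
qed

section \<open>The majorant: upper bound and positivity\<close>

text \<open>All exponents of \<open>g\<close> are lattice points of the polyhedron of
  \<open>f\<close>. The estimate is used for admissible perturbations and for \<open>f\<close>
  itself.\<close>

lemma abs_peval_le_majorant:
  assumes "newton_polyhedron g \<subseteq> newton_polyhedron f"
  shows "\<bar>peval g x\<bar> \<le> coeff_norm g * newton_majorant f x"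
proof -
  let ?L = "newton_lattice_points f"
  have fin: "finite ?L" by (rule finite_newton_lattice_points)
  have "newton_lattice_points g \<subseteq> ?L"
    using assms by (auto simp: newton_lattice_points_def)
  then have "Poly_Mapping.keys g \<subseteq> ?L" using newton_lattice_keys by blast
  then have "peval g x = (\<Sum>\<alpha>\<in>?L. Poly_Mapping.lookup g \<alpha> * monom_eval \<alpha> x)"
    by (intro peval_superset fin)
  also have "\<bar>\<dots>\<bar> \<le> (\<Sum>\<alpha>\<in>?L. \<bar>Poly_Mapping.lookup g \<alpha> * monom_eval \<alpha> x\<bar>)"
    by (rule sum_abs)
  also have "\<dots> \<le> (\<Sum>\<alpha>\<in>?L. coeff_norm g * \<bar>monom_eval \<alpha> x\<bar>)"
    by (intro sum_mono) (auto simp: abs_mult coeff_norm_def intro!: mult_right_mono Max_ge finite_range_coeff)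
  finally show ?thesis by (simp add: newton_majorant_def sum_distrib_left)
qed

lemma newton_majorant_nonneg: "0 \<le> newton_majorant f x"
  by (simp add: newton_majorant_def sum_nonneg)

text \<open>Let J be the support of x. As \<open>f\<close> does not vanish identically on the
  subspace of J, it has a monomial involving only variables from J, and this monomial is nonzero at
  x.\<close>

lemma newton_majorant_pos:
  assumes "nonvanishing_on_coord_subspaces f" and "x \<noteq> 0"
  shows "0 < newton_majorant f x"
proof -
  define J where "J = {j. x $ j \<noteq> 0}"
  have "J \<noteq> {}" using assms(2) by (auto simp: J_def vec_eq_iff)
  then obtain y where y: "y \<in> coord_subspace J" "peval f y \<noteq> 0"
    using assms(1) by (auto simp: nonvanishing_on_coord_subspaces_def)
  then obtain \<alpha> where \<alpha>: "\<alpha> \<in> Poly_Mapping.keys f" "monom_eval \<alpha> y \<noteq> 0"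
    unfolding peval_def by (metis (no_types, lifting) mult_zero_right sum.neutral)
  then have "monom_eval \<alpha> x \<noteq> 0"
    using y(1) by (force simp: monom_eval_eq_0_iff coord_subspace_def J_def)
  then show ?thesis
    unfolding newton_majorant_def
    using \<alpha>(1) newton_lattice_keys[of f]
    by (intro sum_pos2[of _ \<alpha>] finite_newton_lattice_points) auto
qed

section \<open>Stable compactness forces face parts to be nonzero on the torus\<close>

text \<open>In dimension at least two the complement of a ball is connected, so its image under a
  continuous function is an interval, here one avoiding 0.\<close>

lemma constant_sign_outside_cball:
  fixes h :: "'a::euclidean_space \<Rightarrow> real"
  assumes "DIM('a) \<ge> 2" and "continuous_on UNIV h"
    and nz: "\<And>x. norm x > B \<Longrightarrow> h x \<noteq> 0" and "norm x > B" "norm y > B"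
  shows "h x * h y > 0"
proof -
  have "connected (- cball (0::'a) B)"
    using assms(1) by (intro connected_complement_bounded_convex) auto
  then have "connected (h ` (- cball 0 B))"
    using assms(2) by (intro connected_continuous_image) (auto intro: continuous_on_subset)
  moreover have "0 \<notin> h ` (- cball 0 B)"
    using nz by (auto simp: image_iff)
  moreover have "h x \<in> h ` (- cball 0 B)" "h y \<in> h ` (- cball 0 B)"
    using assms by auto
  ultimately have "\<not> (h x \<le> 0 \<and> 0 \<le> h y)" "\<not> (h y \<le> 0 \<and> 0 \<le> h x)"
    unfolding connected_iff_interval by blast+
  then show ?thesis by (auto simp: zero_less_mult_iff not_le)
qed

lemma norm_axis: "norm (axis i c :: real ^ 'n) = \<bar>c\<bar>"
proof -
  have "axis i c = c *\<^sub>R (axis i 1 :: real ^ 'n)" by (simp add: vec_eq_iff axis_def)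
  then show ?thesis by (simp add: norm_axis_1)
qed

lemma stably_compact_imp_face_part_nonzero:
  fixes f :: "'n::finite mpoly"
  assumes "CARD('n) \<ge> 2" and "f \<noteq> 0" and stable: "stably_compact_zero_set f"
    and "\<Delta> \<in> newton_boundary_infinity f" and x: "x \<in> real_torus"
  shows "peval (face_part f \<Delta>) x \<noteq> 0"
proof
  assume zero: "peval (face_part f \<Delta>) x = 0"
  obtain q i where q: "\<Delta> = face q (newton_polyhedron f)" "q $ i < 0"
    using assms(4) by (rule newton_boundary_infinityE)
  define d where "d = face_dist q (newton_polyhedron f)"
  define S where "S = {\<alpha>. \<alpha> \<in> Poly_Mapping.keys f \<and> q \<bullet> exponent_vec \<alpha> = d}"
  have sum0: "(\<Sum>\<alpha>\<in>S. Poly_Mapping.lookup f \<alpha> * monom_eval \<alpha> x) = 0"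
    using zero unfolding q peval_face_part[OF assms(2)] S_def d_def .
  have "S \<noteq> {}"
    using face_dist_attained[OF assms(2), of q] unfolding S_def d_def by (metis (mono_tags, lifting) empty_iff mem_Collect_eq)
  \<comment> \<open>Otherwise the face part would be a nonzero constant and could not vanish at
    x.\<close>
  have "S \<noteq> {0}"
  proof
    assume "S = {0}"
    then have "0 \<in> S" and "Poly_Mapping.lookup f 0 = 0" using sum0 by simp_all
    then show False by (simp add: S_def in_keys_iff)
  qed
  with \<open>S \<noteq> {}\<close> obtain \<alpha> where \<alpha>: "\<alpha> \<in> S" "\<alpha> \<noteq> 0" by blast
  then obtain j where j: "\<alpha> $ j > 0" by (auto simp: vec_eq_iff)
  \<comment> \<open>A second coordinate exists since n \<ge> 2; on its axis the monomial of \<alpha>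
    vanishes.\<close>
  have "card (UNIV - {j}) \<noteq> 0" using assms(1) by (simp add: card_Diff_singleton)
  then have "UNIV - {j} \<noteq> {}" by (metis card.empty)
  then obtain k where k: "k \<noteq> j" by blast
  obtain \<epsilon> where \<epsilon>: "\<epsilon> > 0" and
    comp: "\<And>g. newton_polyhedron g \<subseteq> newton_polyhedron f \<Longrightarrow> coeff_norm g < \<epsilon> \<Longrightarrow> compact (zero_set (f + g))"
    using stable by (auto simp: stably_compact_zero_set_def)
  define h where "h s y = peval f y + s * monom_eval \<alpha> y" for s y
  have cont: "continuous_on UNIV (h s)" for s
    unfolding h_def by (intro continuous_intros)
  have outside: "\<exists>B. \<forall>y. norm y > B \<longrightarrow> h s y \<noteq> 0" if s: "\<bar>s\<bar> < \<epsilon>" "s \<noteq> 0" for s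
  proof -
    let ?g = "Poly_Mapping.single \<alpha> s"
    have "newton_polyhedron ?g \<subseteq> newton_polyhedron f"
      using \<alpha>(1) s(2) by (auto simp: newton_polyhedron_def S_def intro: hull_inc)
    moreover have "coeff_norm ?g < \<epsilon>"
      unfolding coeff_norm_def using s(1) \<epsilon>
      by (subst Max_less_iff[OF finite_range_coeff]) (auto simp: lookup_single when_def)
    ultimately have "compact (zero_set (f + ?g))" by (rule comp)
    then obtain B where "\<And>y. y \<in> zero_set (f + ?g) \<Longrightarrow> norm y \<le> B"
      using compact_imp_bounded bounded_iff by metis
    then show ?thesis
      by (intro exI[of _ B]) (force simp: zero_set_def h_def peval_add peval_single)
  qed
  define \<delta> where "\<delta> = \<epsilon> / 2"
  have \<delta>: "\<delta> > 0" "\<delta> < \<epsilon>" using \<epsilon> by (auto simp: \<delta>_def)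
  obtain B1 where B1: "\<And>y. norm y > B1 \<Longrightarrow> h \<delta> y \<noteq> 0" using outside[of \<delta>] \<delta> by auto
  obtain B2 where B2: "\<And>y. norm y > B2 \<Longrightarrow> h (-\<delta>) y \<noteq> 0" using outside[of "-\<delta>"] \<delta> by auto
  \<comment> \<open>A point of that axis beyond both bounds: there the two perturbations coincide,
    which ties their constant signs together.\<close>
  define z :: "real ^ 'n" where "z = axis k (\<bar>B1\<bar> + \<bar>B2\<bar> + 1)"
  have z: "norm z > B1" "norm z > B2" by (auto simp: z_def norm_axis)
  have "monom_eval \<alpha> z = 0"
    using j k by (auto simp: monom_eval_eq_0_iff z_def axis_def)
  then have hz: "h \<delta> z = h (-\<delta>) z" by (simp add: h_def)
  have pos: "h \<delta> y * h (-\<delta>) y > 0" if y: "norm y > B1" "norm y > B2" for y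
  proof -
    have D: "DIM(real ^ 'n) \<ge> 2" using assms(1) by simp
    have "h \<delta> z * h \<delta> y > 0" "h (-\<delta>) z * h (-\<delta>) y > 0"
      using constant_sign_outside_cball[OF D cont B1 z(1) y(1)]
        constant_sign_outside_cball[OF D cont B2 z(2) y(2)] by auto
    then show ?thesis using hz by (auto simp: zero_less_mult_iff)
  qed
  \<comment> \<open>Since \<alpha> lies on the face, its monomial scales exactly by exp(-t d), while
    the rescaled \<open>f\<close> tends to the vanishing face part. Only the perturbation survives
    in the limit.\<close>
  have lim: "((\<lambda>t. h s (dilate (t *\<^sub>R q) x) * exp (t * d)) \<longlongrightarrow> s * monom_eval \<alpha> x) at_top" for s
  proof -
    have "h s (dilate (t *\<^sub>R q) x) * exp (t * d) =
      peval f (dilate (t *\<^sub>R q) x) * exp (t * d) + s * monom_eval \<alpha> x" for t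
      using \<alpha>(1) by (simp add: h_def monom_eval_dilate S_def distrib_right exp_minus field_simps)
    then show ?thesis
      using tendsto_add[OF peval_dilate_tendsto[OF assms(2), of q x] tendsto_const[of "s * monom_eval \<alpha> x"]]
        zero by (simp add: q d_def)
  qed
  \<comment> \<open>The limit is minus the square of
    \<open>\<delta> * monom_eval \<alpha> x\<close>, hence negative, although the product is
    eventually nonnegative.\<close>
  have "((\<lambda>t. (h \<delta> (dilate (t *\<^sub>R q) x) * exp (t * d)) * (h (-\<delta>) (dilate (t *\<^sub>R q) x) * exp (t * d)))
     \<longlongrightarrow> (\<delta> * monom_eval \<alpha> x) * (- \<delta> * monom_eval \<alpha> x)) at_top"
    by (intro tendsto_mult lim)
  moreover have "\<forall>\<^sub>F t in at_top. norm (dilate (t *\<^sub>R q) x) > max B1 B2"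
    using norm_dilate_at_top[OF x q(2)] by (simp add: filterlim_at_top_dense del: max_less_iff_conj)
  then have "\<forall>\<^sub>F t in at_top.
      0 \<le> (h \<delta> (dilate (t *\<^sub>R q) x) * exp (t * d)) * (h (-\<delta>) (dilate (t *\<^sub>R q) x) * exp (t * d))"
  proof eventually_elim
    case (elim t)
    then have "0 < h \<delta> (dilate (t *\<^sub>R q) x) * h (-\<delta>) (dilate (t *\<^sub>R q) x)"
      by (intro pos) auto
    from mult_nonneg_nonneg[OF less_imp_le[OF this] zero_le_square[of "exp (t * d)"]]
    show ?case by (simp only: mult_ac)
  qed
  ultimately have "0 \<le> (\<delta> * monom_eval \<alpha> x) * (- \<delta> * monom_eval \<alpha> x)"
    by (rule tendsto_lowerbound) simp
  then show False
    using \<delta>(1) monom_eval_torus[OF x, of \<alpha>] by (auto simp: mult_le_0_iff zero_le_mult_iff)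
qed

section \<open>Lower bound of the absolute value of the polynomial by the majorant\<close>

text \<open>The map L x = sum of (x \<bullet> a) a satisfies x \<bullet> L x = sum of (x \<bullet>
  a)^2, so it is injective, hence bounded below, on the span of A. Applied to the span component of
  u, it depends only on the inner products u \<bullet> a. The constant does not depend on u, so a
  whole sequence can be corrected at bounded cost.\<close>

lemma almost_orthogonal_projection:
  fixes A :: "'a::euclidean_space set"
  assumes "finite A"
  obtains C where "\<And>u. \<exists>w. (\<forall>a\<in>A. w \<bullet> a = 0) \<and> norm (u - w) \<le> C * (\<Sum>a\<in>A. \<bar>u \<bullet> a\<bar>)"
proof -
  define L where "L x = (\<Sum>a\<in>A. (x \<bullet> a) *\<^sub>R a)" for x
  have lin: "linear L"
    unfolding L_def by (intro linearI) (auto simp: inner_add_left scaleR_add_left sum.distrib scaleR_sum_right)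
  have inj: "\<forall>x\<in>span A. L x = 0 \<longrightarrow> x = 0"
  proof (intro ballI impI)
    fix x assume x: "x \<in> span A" "L x = 0"
    have "(\<Sum>a\<in>A. (x \<bullet> a)\<^sup>2) = x \<bullet> L x"
      by (simp add: L_def inner_sum_right power2_eq_square)
    with x(2) have "\<forall>a\<in>A. x \<bullet> a = 0"
      by (simp add: sum_nonneg_eq_0_iff assms)
    then have "orthogonal x x"
      using x(1) by (intro orthogonal_to_span[of x A]) (auto simp: orthogonal_def)
    then show "x = 0" by (simp add: orthogonal_self)
  qed
  obtain e where e: "e > 0" "\<And>x. x \<in> span A \<Longrightarrow> norm (L x) \<ge> e * norm x"
    using injective_imp_isometric[OF closed_subspace[OF subspace_span] subspace_span
        linear_conv_bounded_linear[THEN iffD1, OF lin] inj] by auto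
  define M where "M = (\<Sum>a\<in>A. norm a)"
  show ?thesis
  proof (rule that[of "M / e"])
    fix u
    obtain v w where v: "v \<in> span A" and w: "\<And>y. y \<in> span A \<Longrightarrow> orthogonal w y" and u: "u = v + w"
      using orthogonal_subspace_decomp_exists[of A u] by metis
    have w0: "w \<bullet> a = 0" if "a \<in> A" for a
      using w[OF span_base[OF that]] by (simp add: orthogonal_def)
    have "e * norm v \<le> norm (L v)" by (rule e(2)[OF v])
    also have "L v = (\<Sum>a\<in>A. (u \<bullet> a) *\<^sub>R a)"
      unfolding L_def u by (intro sum.cong) (auto simp: inner_add_left w0)
    also have "norm \<dots> \<le> (\<Sum>a\<in>A. \<bar>u \<bullet> a\<bar> * norm a)"
      by (rule order_trans[OF norm_sum]) simp
    also have "\<dots> \<le> (\<Sum>a\<in>A. \<bar>u \<bullet> a\<bar> * M)"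
      unfolding M_def by (intro sum_mono mult_left_mono member_le_sum) (auto simp: assms)
    finally have "norm v \<le> M / e * (\<Sum>a\<in>A. \<bar>u \<bullet> a\<bar>)"
      using e(1) by (simp add: field_simps sum_distrib_left [symmetric])
    then show "\<exists>w. (\<forall>a\<in>A. w \<bullet> a = 0) \<and> norm (u - w) \<le> M / e * (\<Sum>a\<in>A. \<bar>u \<bullet> a\<bar>)"
      using u w0 by (intro exI[of _ w]) auto
  qed
qed

lemma common_convergent_subseq:
  fixes e :: "'a \<Rightarrow> nat \<Rightarrow> real"
  assumes "finite A" and "\<And>a. a \<in> A \<Longrightarrow> bounded (range (e a))"
  shows "\<exists>r l. strict_mono r \<and> (\<forall>a\<in>A. (\<lambda>k. e a (r k)) \<longlonglongrightarrow> l a)"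
  using assms
proof (induction A)
  case empty
  then show ?case by (auto intro: exI[of _ id] strict_mono_id)
next
  case (insert b A)
  then obtain r l where r: "strict_mono r" "\<forall>a\<in>A. (\<lambda>k. e a (r k)) \<longlonglongrightarrow> l a" by auto
  have "bounded (range (\<lambda>k. e b (r k)))"
    by (rule bounded_subset[OF insert.prems[of b]]) auto
  then obtain c r' where r': "strict_mono r'" "((\<lambda>k. e b (r k)) \<circ> r') \<longlonglongrightarrow> c"
    using bounded_imp_convergent_subsequence by blast
  have "\<forall>a\<in>insert b A. (\<lambda>k. e a ((r \<circ> r') k)) \<longlonglongrightarrow> (l(b := c)) a"
    using LIMSEQ_subseq_LIMSEQ[OF _ r'(1)] r r' by (auto simp: o_def)
  then show ?case using strict_mono_o[OF r(1) r'(1)] by blast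
qed

text \<open>Replacing the zero coordinates by a small positive number moves a point into the
  torus.\<close>

lemma open_meets_real_torus:
  assumes "open U" and "x \<in> U"
  shows "\<exists>y\<in>U. y \<in> real_torus"
proof -
  define y where "y e = (\<chi> j. if x $ j = 0 then e else x $ j)" for e :: real
  have "(y \<longlongrightarrow> x) (at_right 0)"
    unfolding y_def
  proof (intro vec_tendstoI)
    fix i
    show "((\<lambda>e. (\<chi> j. if x $ j = 0 then e else x $ j) $ i) \<longlongrightarrow> x $ i) (at_right 0)"
      by (cases "x $ i = 0") (auto intro: tendsto_ident_at)
  qed
  then have "\<forall>\<^sub>F e in at_right 0. y e \<in> U"
    using assms by (rule topological_tendstoD)
  moreover have "\<forall>\<^sub>F e::real in at_right 0. e > 0" by (simp add: eventually_at_right_less)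
  ultimately have "\<forall>\<^sub>F e in at_right 0. y e \<in> U \<and> e > 0" by (rule eventually_conj)
  then obtain e where "y e \<in> U" "e > 0"
    by (metis (mono_tags, lifting) eventually_happens trivial_limit_at_right_real)
  then show ?thesis by (intro bexI[of _ "y e"]) (auto simp: y_def real_torus_def)
qed

lemma filterlim_at_top_if_exp_minus_tendsto_0:
  fixes g :: "'a \<Rightarrow> real"
  assumes "((\<lambda>k. exp (- g k)) \<longlongrightarrow> 0) F"
  shows "filterlim g at_top F"
  unfolding filterlim_at_top
proof
  fix Z :: real
  have "\<forall>\<^sub>F k in F. exp (- g k) < exp (- Z)"
    by (rule order_tendstoD(2)[OF assms]) simp
  then show "\<forall>\<^sub>F k in F. Z \<le> g k" by eventually_elim simp
qed

text \<open>A torus point is a dilation of its sign vector, on which all monomials have modulus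
  1.\<close>

lemma abs_monom_eval_torus:
  assumes "x \<in> real_torus"
  shows "\<bar>monom_eval \<alpha> x\<bar> = exp (- ((\<chi> j. - ln \<bar>x $ j\<bar>) \<bullet> exponent_vec \<alpha>))"
proof -
  define s where "s = (\<chi> j. sgn (x $ j))"
  have "x = dilate (\<chi> j. - ln \<bar>x $ j\<bar>) s"
    using assms by (auto simp: vec_eq_iff dilate_def s_def real_torus_def sgn_mult_abs)
  moreover have "\<bar>monom_eval \<alpha> s\<bar> = 1"
    using assms by (auto simp: monom_eval_def s_def abs_prod power_abs real_torus_def abs_sgn_eq)
  ultimately show ?thesis
    using monom_eval_dilate[of \<alpha> "\<chi> j. - ln \<bar>x $ j\<bar>" s] by (simp add: abs_mult)
qed

lemma majorant_le_abs_peval: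
  fixes f :: "'n::finite mpoly"
  assumes "f \<noteq> 0"
    and nz: "\<And>\<Delta> x. \<Delta> \<in> newton_boundary_infinity f \<Longrightarrow> x \<in> real_torus \<Longrightarrow> peval (face_part f \<Delta>) x \<noteq> 0"
  shows "\<exists>c>0. \<exists>R>0. \<forall>x. norm x > R \<longrightarrow> c * newton_majorant f x \<le> \<bar>peval f x\<bar>"
proof (rule ccontr)
  assume neg: "\<not> ?thesis"
  have "\<exists>x. x \<in> real_torus \<and> norm x > real k + 1 \<and>
      \<bar>peval f x\<bar> \<le> newton_majorant f x / (real k + 1)" for k :: nat
  proof -
    have "1 / (real k + 1) > 0" "real k + 1 > 0" by auto
    then have "\<not> (\<forall>x. norm x > real k + 1 \<longrightarrow> 1 / (real k + 1) * newton_majorant f x \<le> \<bar>peval f x\<bar>)"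
      using neg by blast
    then obtain x0 where x0: "norm x0 > real k + 1" "\<bar>peval f x0\<bar> < newton_majorant f x0 / (real k + 1)"
      by (auto simp: not_le)
    \<comment> \<open>Strict inequalities make the violation of the bound an open condition, so the
      violating point may be taken in the torus, where logarithms are available.\<close>
    let ?U = "{x. real k + 1 < norm x \<and> \<bar>peval f x\<bar> < newton_majorant f x / (real k + 1)}"
    have "open ?U"
      by (intro open_Collect_conj open_Collect_less continuous_intros) auto
    from open_meets_real_torus[OF this, of x0] x0 show ?thesis by force
  qed
  then obtain X where X: "\<And>k. X k \<in> real_torus" "\<And>k. norm (X k) > real k + 1"
    "\<And>k. \<bar>peval f (X k)\<bar> \<le> newton_majorant f (X k) / (real k + 1)"
    by metis
  let ?K = "Poly_Mapping.keys f"
  \<comment> \<open>Dividing by this sum turns the monomials of \<open>f\<close> into weights with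
    total 1; their limits along a subsequence then also have sum 1, so some limit is
    positive.\<close>
  define T where "T k = (\<Sum>\<beta>\<in>?K. \<bar>monom_eval \<beta> (X k)\<bar>)" for k
  define E where "E \<alpha> k = \<bar>monom_eval \<alpha> (X k)\<bar> / T k" for \<alpha> k
  have T: "T k > 0" for k
    unfolding T_def using assms(1) by (intro sum_pos) (auto simp: monom_eval_torus[OF X(1)])
  have E_bounds: "0 \<le> E \<alpha> k" "E \<alpha> k \<le> 1" if "\<alpha> \<in> ?K" for \<alpha> k
  proof -
    have "\<bar>monom_eval \<alpha> (X k)\<bar> \<le> T k"
      unfolding T_def by (rule member_le_sum[OF that]) auto
    then show "0 \<le> E \<alpha> k" "E \<alpha> k \<le> 1" using T[of k] by (auto simp: E_def)
  qed
  have "\<exists>r l. strict_mono r \<and> (\<forall>\<alpha>\<in>?K. (\<lambda>k. E \<alpha> (r k)) \<longlonglongrightarrow> l \<alpha>)"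
    using E_bounds by (intro common_convergent_subseq boundedI[of _ 1]) auto
  then obtain r l where r: "strict_mono r" and l: "\<And>\<alpha>. \<alpha> \<in> ?K \<Longrightarrow> (\<lambda>k. E \<alpha> (r k)) \<longlonglongrightarrow> l \<alpha>"
    by blast
  have l0: "0 \<le> l \<alpha>" if "\<alpha> \<in> ?K" for \<alpha>
    using E_bounds(1)[OF that] by (intro LIMSEQ_le_const[OF l[OF that]]) auto
  have "(\<Sum>\<alpha>\<in>?K. E \<alpha> k) = 1" for k
    using T[of k] by (simp add: E_def T_def sum_divide_distrib [symmetric])
  then have "(\<lambda>k. 1) \<longlonglongrightarrow> (\<Sum>\<alpha>\<in>?K. l \<alpha>)"
    using tendsto_sum[OF l, of ?K "\<lambda>\<alpha>. \<alpha>"] by simp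
  then have "(\<Sum>\<alpha>\<in>?K. l \<alpha>) = 1"
    using LIMSEQ_unique tendsto_const by blast
  then obtain \<alpha>0 where \<alpha>0: "\<alpha>0 \<in> ?K" "l \<alpha>0 > 0"
    using l0 by (metis less_eq_real_def sum.neutral zero_neq_one)

  \<comment> \<open>Because \<open>k \<le> r k\<close>, the subsequence inherits both estimates with
    \<open>k\<close> itself in them.\<close>
  define Z where "Z k = X (r k)" for k
  have Z1: "Z k \<in> real_torus" for k by (simp add: Z_def X)
  have Z2: "norm (Z k) > real k + 1" for k
    using X(2)[of "r k"] seq_suble[OF r, of k] by (simp add: Z_def)
  have Z3: "\<bar>peval f (Z k)\<bar> \<le> newton_majorant f (Z k) / (real k + 1)" for k
    using seq_suble[OF r, of k] unfolding Z_def
    by (intro order_trans[OF X(3)] divide_left_mono) (auto simp: newton_majorant_nonneg)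
  define u where "u k = (\<chi> j. - ln \<bar>Z k $ j\<bar>)" for k
  define D where "D \<alpha> = exponent_vec \<alpha> - exponent_vec \<alpha>0" for \<alpha> :: "nat ^ 'n"
  have ratio: "(\<lambda>k. exp (- (u k \<bullet> D \<alpha>))) \<longlonglongrightarrow> l \<alpha> / l \<alpha>0" if "\<alpha> \<in> ?K" for \<alpha>
  proof -
    have "exp (- (u k \<bullet> D \<alpha>)) = E \<alpha> (r k) / E \<alpha>0 (r k)" for k
      using T[of "r k"] abs_monom_eval_torus[OF Z1[of k], of \<alpha>] abs_monom_eval_torus[OF Z1[of k], of \<alpha>0]
      by (simp add: E_def D_def inner_diff_right exp_diff [symmetric] u_def [symmetric] flip: Z_def)
    then show ?thesis
      using tendsto_divide[OF l[OF that] l[OF \<alpha>0(1)]] \<alpha>0(2) by simp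
  qed
  \<comment> \<open>These monomials are comparable to that of the reference exponent
    \<open>\<alpha>0\<close>. On \<open>S\<close> the values \<open>u k \<bullet> D \<alpha>\<close>
    converge; for the other exponents of \<open>f\<close> they tend to infinity.\<close>
  define S where "S = {\<alpha> \<in> ?K. l \<alpha> > 0}"
  have S: "finite S" "S \<subseteq> ?K" "\<alpha>0 \<in> S" using \<alpha>0 by (auto simp: S_def)
  have conv: "convergent (\<lambda>k. u k \<bullet> D \<alpha>)" if "\<alpha> \<in> S" for \<alpha>
  proof -
    have "(\<lambda>k. - ln (exp (- (u k \<bullet> D \<alpha>)))) \<longlonglongrightarrow> - ln (l \<alpha> / l \<alpha>0)"
      using that \<alpha>0 by (intro tendsto_minus tendsto_ln ratio) (auto simp: S_def)
    then show ?thesis by (auto simp: convergent_def)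
  qed
  have div: "filterlim (\<lambda>k. u k \<bullet> D \<alpha>) at_top sequentially" if "\<alpha> \<in> ?K - S" for \<alpha>
  proof -
    have "l \<alpha> = 0" using that l0[of \<alpha>] by (auto simp: S_def)
    with ratio[of \<alpha>] that show ?thesis
      by (intro filterlim_at_top_if_exp_minus_tendsto_0) simp
  qed

  \<comment> \<open>The values \<open>u k \<bullet> D \<alpha>\<close> with \<alpha> in
    \<open>S\<close> are bounded, so making them exactly zero displaces \<open>u k\<close> by at
    most a constant \<open>B\<close>. Such a displacement does not affect divergence for the
    remaining exponents.\<close>
  obtain C where "\<And>v. \<exists>w. (\<forall>a\<in>D ` S. w \<bullet> a = 0) \<and> norm (v - w) \<le> C * (\<Sum>a\<in>D ` S. \<bar>v \<bullet> a\<bar>)"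
    using almost_orthogonal_projection[of "D ` S"] S(1) by blast
  then obtain w where w: "\<And>k \<alpha>. \<alpha> \<in> S \<Longrightarrow> w k \<bullet> D \<alpha> = 0"
    and w': "\<And>k. norm (u k - w k) \<le> C * (\<Sum>a\<in>D ` S. \<bar>u k \<bullet> a\<bar>)"
    by (metis imageI)
  have "convergent (\<lambda>k. \<bar>u k \<bullet> D \<alpha>\<bar>)" if "\<alpha> \<in> S" for \<alpha>
    using conv[OF that] by (auto simp: convergent_def intro: tendsto_rabs)
  then have "convergent (\<lambda>k. C * (\<Sum>a\<in>D ` S. \<bar>u k \<bullet> a\<bar>))"
    by (intro convergent_mult convergent_const convergent_sum) auto
  then obtain B where "\<And>k. \<bar>C * (\<Sum>a\<in>D ` S. \<bar>u k \<bullet> a\<bar>)\<bar> \<le> B"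
    using convergent_imp_Bseq BseqE by (metis real_norm_def)
  then have B: "norm (u k - w k) \<le> B" for k
    using w'[of k] by (meson abs_ge_self order_trans)
  have wdiv: "filterlim (\<lambda>k. w k \<bullet> D \<alpha>) at_top sequentially" if "\<alpha> \<in> ?K - S" for \<alpha>
  proof (rule filterlim_at_top_mono)
    show "filterlim (\<lambda>k. - (B * norm (D \<alpha>)) + u k \<bullet> D \<alpha>) at_top sequentially"
      by (rule filterlim_tendsto_add_at_top[OF tendsto_const div[OF that]])
    have "- (B * norm (D \<alpha>)) + u k \<bullet> D \<alpha> \<le> w k \<bullet> D \<alpha>" for k
    proof -
      have "(u k - w k) \<bullet> D \<alpha> \<le> norm (u k - w k) * norm (D \<alpha>)" by (rule norm_cauchy_schwarz)
      also have "\<dots> \<le> B * norm (D \<alpha>)" by (intro mult_right_mono B) auto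
      finally show ?thesis by (simp add: inner_diff_left)
    qed
    then show "\<forall>\<^sub>F k in sequentially. - (B * norm (D \<alpha>)) + u k \<bullet> D \<alpha> \<le> w k \<bullet> D \<alpha>" by simp
  qed

  \<comment> \<open>Removing the dilation by \<open>w k\<close> leaves coordinates of modulus
    between exp(-B) and exp(B). Hence a subsequence converges, and its limit stays in the
    torus.\<close>
  define Y where "Y k = dilate (- w k) (Z k)" for k
  have ZY: "Z k = dilate (w k) (Y k)" for k
    by (simp add: Y_def dilate_def vec_eq_iff exp_minus field_simps)
  have Yj: "\<bar>Y k $ j\<bar> = exp (w k $ j - u k $ j)" for k j
    using Z1[of k] by (simp add: Y_def dilate_def abs_mult u_def exp_add real_torus_def mult.commute)
  have wu: "\<bar>w k $ j - u k $ j\<bar> \<le> B" for k j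
    using component_le_norm_cart[of "u k - w k" j] B[of k] by simp
  have Y_lower: "exp (- B) \<le> \<bar>Y k $ j\<bar>" and Y_upper: "\<bar>Y k $ j\<bar> \<le> exp B" for k j
    using wu[of k j] by (auto simp: Yj)
  define N where "N = real CARD('n) * exp B"
  have N: "norm (Y k) \<le> N" for k
  proof -
    have "norm (Y k) \<le> (\<Sum>j\<in>UNIV. \<bar>Y k $ j\<bar>)" by (rule norm_le_l1_cart)
    also have "\<dots> \<le> (\<Sum>j\<in>(UNIV :: 'n set). exp B)" by (intro sum_mono Y_upper)
    finally show ?thesis by (simp add: N_def)
  qed
  then have "bounded (range Y)" by (auto intro: boundedI)
  then obtain y p where p: "strict_mono p" and y: "(Y \<circ> p) \<longlonglongrightarrow> y"
    using bounded_imp_convergent_subsequence by blast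
  have y': "(\<lambda>k. Y (p k)) \<longlonglongrightarrow> y" using y by (simp add: o_def)
  have y_lower: "exp (- B) \<le> \<bar>y $ j\<bar>" for j
    using Y_lower by (intro LIMSEQ_le_const[OF tendsto_rabs[OF tendsto_vec_nth[OF y']]]) auto
  have "y $ j \<noteq> 0" for j
  proof
    assume "y $ j = 0"
    with y_lower[of j] exp_gt_zero[of "- B"] show False by simp
  qed
  then have y_torus: "y \<in> real_torus" by (simp add: real_torus_def)

  define good where "good k \<longleftrightarrow> (\<exists>j. w k $ j < 0) \<and> (\<forall>\<alpha>\<in>?K - S. 0 < w k \<bullet> D \<alpha>)" for k
  \<comment> \<open>Without a negative coordinate, dilating by \<open>w k\<close> would not increase
    norms, and the norm of \<open>Z k\<close> would be at most \<open>N\<close>, contradicting its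
    growth.\<close>
  have "\<forall>\<^sub>F k in sequentially. \<exists>j. w k $ j < 0"
    using eventually_ge_at_top[of "nat \<lceil>N\<rceil>"]
  proof eventually_elim
    case (elim k)
    show ?case
    proof (rule ccontr)
      assume "\<not> ?case"
      then have "norm (Z k) \<le> norm (Y k)"
        by (intro norm_le_componentwise_cart)
          (auto simp: ZY[of k] dilate_def abs_mult not_less intro!: mult_left_le)
      with N[of k] Z2[of k] elim show False by linarith
    qed
  qed
  moreover have "\<forall>\<^sub>F k in sequentially. \<forall>\<alpha>\<in>?K - S. 0 < w k \<bullet> D \<alpha>"
    using wdiv by (intro eventually_ball_finite) (auto simp: filterlim_at_top_dense)
  ultimately have good: "\<forall>\<^sub>F k in sequentially. good k"
    unfolding good_def by (rule eventually_conj)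
  have w_ge: "w k \<bullet> exponent_vec \<alpha>0 \<le> w k \<bullet> exponent_vec \<alpha>" if "good k" "\<alpha> \<in> ?K" for k \<alpha>
  proof -
    have "0 \<le> w k \<bullet> D \<alpha>"
      using that w[of \<alpha> k] by (cases "\<alpha> \<in> S") (auto simp: good_def intro: less_imp_le)
    then show ?thesis by (simp add: D_def inner_diff_right)
  qed

  \<comment> \<open>One good index suffices, because \<open>S\<close> does not depend on
    \<open>k\<close>: there \<open>S\<close> consists of the exponents on the face selected by
    \<open>w k\<close>, which is a face at infinity.\<close>
  have nonzero: "(\<Sum>\<alpha>\<in>S. Poly_Mapping.lookup f \<alpha> * monom_eval \<alpha> y) \<noteq> 0"
  proof -
    obtain k where k: "good k"
      using good by (metis (mono_tags, lifting) eventually_happens sequentially_bot)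
    then obtain j where j: "w k $ j < 0" by (auto simp: good_def)
    have d: "face_dist (w k) (newton_polyhedron f) = w k \<bullet> exponent_vec \<alpha>0"
      by (rule face_dist_newton_polyhedron) (use \<alpha>0 w_ge k in auto)
    have "\<alpha> \<in> S \<longleftrightarrow> \<alpha> \<in> ?K \<and> w k \<bullet> exponent_vec \<alpha> = w k \<bullet> exponent_vec \<alpha>0" for \<alpha>
    proof (cases "\<alpha> \<in> S")
      case True
      with S(2) w[of \<alpha> k] show ?thesis by (auto simp: D_def inner_diff_right)
    next
      case False
      with k have "\<alpha> \<in> ?K \<Longrightarrow> 0 < w k \<bullet> D \<alpha>" by (simp add: good_def)
      with False show ?thesis by (auto simp: D_def inner_diff_right)
    qed
    then have "S = {\<alpha>. \<alpha> \<in> ?K \<and> w k \<bullet> exponent_vec \<alpha> = w k \<bullet> exponent_vec \<alpha>0}" by blast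
    with nz[OF newton_boundary_infinityI[OF j] y_torus] show ?thesis
      unfolding peval_face_part[OF assms(1)] d by simp
  qed

  \<comment> \<open>Rescaling by the dominant order: terms outside \<open>S\<close> die out and
    those in \<open>S\<close> keep the factor 1, so along \<open>p\<close> the limit is the nonzero
    face part at \<open>y\<close>.\<close>
  define H where "H k = peval f (Z k) * exp (w k \<bullet> exponent_vec \<alpha>0)" for k
  have scale: "monom_eval \<alpha> (Z k) * exp (w k \<bullet> exponent_vec \<alpha>0) = monom_eval \<alpha> (Y k) * exp (- (w k \<bullet> D \<alpha>))"
    for \<alpha> k
    by (subst ZY) (simp add: monom_eval_dilate D_def inner_diff_right exp_diff exp_minus field_simps)
  have H: "H k = (\<Sum>\<alpha>\<in>?K. Poly_Mapping.lookup f \<alpha> * (monom_eval \<alpha> (Y k) * exp (- (w k \<bullet> D \<alpha>))))" for k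
    by (simp add: H_def peval_def sum_distrib_right mult.assoc scale)
  have "(\<lambda>k. H (p k)) \<longlonglongrightarrow>
      (\<Sum>\<alpha>\<in>?K. Poly_Mapping.lookup f \<alpha> * (monom_eval \<alpha> y * (if \<alpha> \<in> S then 1 else 0)))"
    unfolding H
  proof (intro tendsto_intros y')
    fix \<alpha> assume a: "\<alpha> \<in> ?K"
    show "(\<lambda>k. exp (- (w (p k) \<bullet> D \<alpha>))) \<longlonglongrightarrow> (if \<alpha> \<in> S then 1 else 0)"
    proof (cases "\<alpha> \<in> S")
      case False
      then have "filterlim (\<lambda>k. w (p k) \<bullet> D \<alpha>) at_top sequentially"
        using a by (intro filterlim_compose[OF wdiv filterlim_subseq[OF p]]) auto
      then have "filterlim (\<lambda>k. - (w (p k) \<bullet> D \<alpha>)) at_bot sequentially"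
        by (simp add: filterlim_uminus_at_bot)
      from filterlim_compose[OF exp_at_bot this] False show ?thesis by simp
    qed (simp add: w)
  qed
  also have "(\<Sum>\<alpha>\<in>?K. Poly_Mapping.lookup f \<alpha> * (monom_eval \<alpha> y * (if \<alpha> \<in> S then 1 else 0))) =
      (\<Sum>\<alpha>\<in>S. Poly_Mapping.lookup f \<alpha> * monom_eval \<alpha> y)"
    using S by (intro sum.mono_neutral_cong_right) auto
  finally have lim: "(\<lambda>k. H (p k)) \<longlonglongrightarrow> (\<Sum>\<alpha>\<in>S. Poly_Mapping.lookup f \<alpha> * monom_eval \<alpha> y)" .

  \<comment> \<open>The majorant may contain lattice points that are not exponents of
    \<open>f\<close>. The half-space bound covers them too, so no rescaled term exceeds its value at
    \<open>Y k\<close>; the factor 1/(k+1) then drives \<open>H\<close> to 0.\<close>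
  have H_le: "\<bar>H k\<bar> \<le> 1 / (real k + 1) * newton_majorant f (Y k)" if k: "good k" for k
  proof -
    have "\<bar>H k\<bar> \<le> newton_majorant f (Z k) / (real k + 1) * exp (w k \<bullet> exponent_vec \<alpha>0)"
      unfolding H_def abs_mult abs_exp_cancel by (rule mult_right_mono[OF Z3]) simp
    also have "\<dots> = 1 / (real k + 1) * (\<Sum>\<alpha>\<in>newton_lattice_points f. \<bar>monom_eval \<alpha> (Z k) * exp (w k \<bullet> exponent_vec \<alpha>0)\<bar>)"
      by (simp add: newton_majorant_def sum_distrib_right abs_mult)
    also have "\<dots> \<le> 1 / (real k + 1) * newton_majorant f (Y k)"
      unfolding newton_majorant_def scale
    proof (intro mult_left_mono sum_mono)
      fix \<alpha> assume "\<alpha> \<in> newton_lattice_points f"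
      then have "w k \<bullet> exponent_vec \<alpha>0 \<le> w k \<bullet> exponent_vec \<alpha>"
        using newton_polyhedron_lower_bound[OF w_ge[OF k]] by (auto simp: newton_lattice_points_def)
      then show "\<bar>monom_eval \<alpha> (Y k) * exp (- (w k \<bullet> D \<alpha>))\<bar> \<le> \<bar>monom_eval \<alpha> (Y k)\<bar>"
        by (auto simp: abs_mult D_def inner_diff_right intro!: mult_left_le)
    qed auto
    finally show ?thesis .
  qed
  have "(\<lambda>k. 1 / (real k + 1)) \<longlonglongrightarrow> 0"
    using LIMSEQ_inverse_real_of_nat by (simp add: inverse_eq_divide add.commute)
  then have "(\<lambda>k. 1 / (real (p k) + 1)) \<longlonglongrightarrow> 0"
    by (rule filterlim_compose[OF _ filterlim_subseq[OF p]])
  then have bound_lim: "(\<lambda>k. 1 / (real (p k) + 1) * newton_majorant f (Y (p k))) \<longlonglongrightarrow> 0 * newton_majorant f y"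
    unfolding newton_majorant_def by (intro tendsto_intros y')
  have "\<forall>\<^sub>F k in sequentially. good (p k)"
    using good filterlim_subseq[OF p] by (auto simp: filterlim_iff)
  then have "\<forall>\<^sub>F k in sequentially. norm (H (p k)) \<le> 1 / (real (p k) + 1) * newton_majorant f (Y (p k))"
    by eventually_elim (use H_le in auto)
  from Lim_null_comparison[OF this] bound_lim have "(\<lambda>k. H (p k)) \<longlonglongrightarrow> 0"
    by simp
  from LIMSEQ_unique[OF this lim] nonzero show False by simp
qed

section \<open>Implications between the conditions, and the equivalences\<close>

text \<open>The lower bound on the modulus and the positivity of the majorant exclude zeros outside
  a ball; connectedness then gives one sign \<sigma> there, which can be read off at any point
  \<open>z\<close> outside.\<close>

lemma face_parts_nonzero_imp_majorant_bounds:
  fixes f :: "'n::finite mpoly"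
  assumes "CARD('n) \<ge> 2" and "f \<noteq> 0" and "nonvanishing_on_coord_subspaces f"
    and "\<And>\<Delta> x. \<Delta> \<in> newton_boundary_infinity f \<Longrightarrow> x \<in> real_torus \<Longrightarrow> peval (face_part f \<Delta>) x \<noteq> 0"
  shows "\<exists>\<sigma>\<in>{-1, 1}. \<exists>c\<^sub>1>0. \<exists>c\<^sub>2>0. \<exists>R>0. \<forall>x. norm x > R \<longrightarrow>
           c\<^sub>1 * newton_majorant f x \<le> \<sigma> * peval f x \<and>
           \<sigma> * peval f x \<le> c\<^sub>2 * newton_majorant f x"
proof -
  obtain c R where c: "c > 0" and R: "R > 0"
    and le: "\<And>x. norm x > R \<Longrightarrow> c * newton_majorant f x \<le> \<bar>peval f x\<bar>"
    using majorant_le_abs_peval[OF assms(2,4)] by blast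
  have nz: "peval f x \<noteq> 0" if "norm x > R" for x
  proof -
    have "x \<noteq> 0" using that R by auto
    with newton_majorant_pos[OF assms(3)] c have "0 < c * newton_majorant f x" by simp
    with le[OF that] show ?thesis by auto
  qed
  have D: "DIM(real ^ 'n) \<ge> 2" using assms(1) by simp
  have cont: "continuous_on UNIV (peval f)"
    using continuous_on_peval[OF continuous_on_id, of UNIV f] by simp
  obtain z :: "real ^ 'n" where z: "norm z = R + 1"
    using vector_choose_size[of "R + 1"] R by auto
  define \<sigma> where "\<sigma> = sgn (peval f z)"
  have "peval f z \<noteq> 0" using nz[of z] z by simp
  then have \<sigma>: "\<sigma> \<in> {-1, 1}" by (auto simp: \<sigma>_def sgn_if)
  have abs: "\<sigma> * peval f x = \<bar>peval f x\<bar>" if "norm x > R" for x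
    using constant_sign_outside_cball[where B = R, OF D cont nz, where x = z and y = x] z that
    by (auto simp: \<sigma>_def zero_less_mult_iff)
  \<comment> \<open>The absolute value and the added 1 make the constant visibly positive.\<close>
  have "\<bar>peval f x\<bar> \<le> (\<bar>coeff_norm f\<bar> + 1) * newton_majorant f x" for x
    by (rule order_trans[OF abs_peval_le_majorant[OF order_refl] mult_right_mono])
      (auto simp: newton_majorant_nonneg)
  then show ?thesis
    using c R le abs by (intro bexI[OF _ \<sigma>] exI[of _ c] conjI exI[of _ "\<bar>coeff_norm f\<bar> + 1"] exI[of _ R]) auto
qed

text \<open>The constant \<open>c\<close> itself serves as the stability radius: outside the ball, a
  perturbation of smaller coefficient norm is strictly dominated by \<open>f\<close>.\<close>

lemma majorant_bound_imp_stably_compact: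
  assumes "nonvanishing_on_coord_subspaces f" and "c > 0" "R > 0" "\<sigma> \<in> {-1, 1::real}"
    and le: "\<And>x. norm x > R \<Longrightarrow> c * newton_majorant f x \<le> \<sigma> * peval f x"
  shows "stably_compact_zero_set f"
  unfolding stably_compact_zero_set_def
proof (intro exI[of _ c] conjI allI impI \<open>c > 0\<close>)
  fix g assume g: "newton_polyhedron g \<subseteq> newton_polyhedron f \<and> coeff_norm g < c"
  have "norm x \<le> R" if x: "x \<in> zero_set (f + g)" for x
  proof (rule ccontr)
    assume "\<not> norm x \<le> R"
    then have R: "norm x > R" "x \<noteq> 0" using \<open>R > 0\<close> by auto
    have "c * newton_majorant f x \<le> \<bar>peval f x\<bar>"
      using le[OF R(1)] assms(4) by auto
    also have "\<dots> = \<bar>peval g x\<bar>"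
      using x by (simp add: zero_set_def peval_add add_eq_0_iff)
    also have "\<dots> \<le> coeff_norm g * newton_majorant f x"
      using g by (intro abs_peval_le_majorant) auto
    also have "\<dots> < c * newton_majorant f x"
      using g newton_majorant_pos[OF assms(1) R(2)] by simp
    finally show False by simp
  qed
  then show "compact (zero_set (f + g))"
    by (auto simp: compact_eq_bounded_closed closed_zero_set bounded_iff)
qed

text \<open>Stability with the zero perturbation bounds the zero set of \<open>f\<close>, whereas
  vanishing on a coordinate subspace would put a whole axis into it.\<close>

lemma stably_compact_imp_nonvanishing:
  assumes "stably_compact_zero_set f"
  shows "nonvanishing_on_coord_subspaces f"
  unfolding nonvanishing_on_coord_subspaces_def
proof (intro allI impI notI)
  fix J assume J: "J \<noteq> {}" "\<forall>x\<in>coord_subspace J. peval f x = 0"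
  then obtain j where j: "j \<in> J" by blast
  have "newton_polyhedron 0 \<subseteq> newton_polyhedron f" by (simp add: newton_polyhedron_def)
  moreover have "coeff_norm 0 = 0" by (simp add: coeff_norm_def)
  ultimately have "compact (zero_set (f + 0))"
    using assms unfolding stably_compact_zero_set_def by metis
  then have "bounded (zero_set f)" by (simp add: compact_imp_bounded)
  then obtain B where B: "\<And>x. x \<in> zero_set f \<Longrightarrow> norm x \<le> B"
    by (auto simp: bounded_iff)
  have "axis j (\<bar>B\<bar> + 1) \<in> coord_subspace J"
    using j by (auto simp: coord_subspace_def axis_def)
  then have "axis j (\<bar>B\<bar> + 1) \<in> zero_set f" using J by (simp add: zero_set_def)
  from B[OF this] show False by (simp add: norm_axis)
qed

text \<open>Here x minimises \<sigma> g on the torus. Changing one coordinate by less than its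
  modulus stays in the torus, so the one-variable test for local minima applies.\<close>

lemma partial_deriv_zero_at_torus_minimum:
  assumes "\<And>y. y \<in> real_torus \<Longrightarrow> 0 \<le> \<sigma> * peval g y" and "\<sigma> \<noteq> 0"
    and x: "x \<in> real_torus" "peval g x = 0"
  shows "partial_deriv g j x = 0"
proof -
  define \<phi> where "\<phi> t = peval g (\<chi> i. if i = j then t else x $ i)" for t
  define c where "c \<alpha> = (\<Prod>i\<in>UNIV - {j}. (x $ i) ^ (\<alpha> $ i))" for \<alpha> :: "nat ^ 'a"
  \<comment> \<open>Displaying the restriction as a polynomial in \<open>t\<close> supplies the
    differentiability that gives \<open>deriv\<close> its usual meaning.\<close>
  have "monom_eval \<alpha> (\<chi> i. if i = j then t else x $ i) = t ^ (\<alpha> $ j) * c \<alpha>" for \<alpha> t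
    unfolding monom_eval_def c_def by (subst prod.remove[of _ j]) (auto intro!: prod.cong)
  then have "\<phi> = (\<lambda>t. \<Sum>\<alpha>\<in>Poly_Mapping.keys g. Poly_Mapping.lookup g \<alpha> * (t ^ (\<alpha> $ j) * c \<alpha>))"
    by (simp add: \<phi>_def peval_def fun_eq_iff)
  then have "\<phi> differentiable (at (x $ j))" by simp
  then obtain d where d: "(\<phi> has_real_derivative d) (at (x $ j))"
    by (auto simp: real_differentiable_def)
  have "(\<chi> i. if i = j then x $ j else x $ i) = x" by (simp add: vec_eq_iff)
  then have 0: "\<phi> (x $ j) = 0" using x by (simp add: \<phi>_def)
  have pos: "0 \<le> \<sigma> * \<phi> t" if "t \<noteq> 0" for t
    unfolding \<phi>_def using x(1) that by (intro assms(1)) (auto simp: real_torus_def)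
  have "\<sigma> * d = 0"
  proof (rule DERIV_local_min)
    show "((\<lambda>t. \<sigma> * \<phi> t) has_real_derivative \<sigma> * d) (at (x $ j))"
      by (rule DERIV_cmult[OF d])
    show "0 < \<bar>x $ j\<bar>" using x(1) by (simp add: real_torus_def)
    show "\<forall>t. \<bar>x $ j - t\<bar> < \<bar>x $ j\<bar> \<longrightarrow> \<sigma> * \<phi> (x $ j) \<le> \<sigma> * \<phi> t"
      using pos by (auto simp: 0)
  qed
  with assms(2) have "d = 0" by simp
  with d show ?thesis
    unfolding partial_deriv_def \<phi>_def by (auto dest: DERIV_imp_deriv)
qed

theorem theorem3p3:
  fixes f :: "'n::finite mpoly"
  assumes "CARD('n) \<ge> 2"
    and "\<not> peval f constant_on UNIV"
  shows
    "(stably_compact_zero_set f \<longleftrightarrow>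
        nonvanishing_on_coord_subspaces f \<and>
        (\<forall>\<Delta>\<in>newton_boundary_infinity f. \<forall>x\<in>real_torus. peval (face_part f \<Delta>) x \<noteq> 0))
     \<and>
     (stably_compact_zero_set f \<longleftrightarrow>
        nonvanishing_on_coord_subspaces f \<and>
        ((\<forall>\<Delta>\<in>newton_boundary_infinity f. \<forall>x\<in>real_torus. peval (face_part f \<Delta>) x > 0) \<or>
         (\<forall>\<Delta>\<in>newton_boundary_infinity f. \<forall>x\<in>real_torus. peval (face_part f \<Delta>) x < 0)))
     \<and>
     (stably_compact_zero_set f \<longleftrightarrow>
        nonvanishing_on_coord_subspaces f \<and>
        (\<exists>\<sigma>\<in>{-1, 1}. \<exists>c\<^sub>1>0. \<exists>c\<^sub>2>0. \<exists>R>0. \<forall>x. norm x > R \<longrightarrow>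
           c\<^sub>1 * newton_majorant f x \<le> \<sigma> * peval f x \<and>
           \<sigma> * peval f x \<le> c\<^sub>2 * newton_majorant f x))
     \<and>
     (stably_compact_zero_set f \<longleftrightarrow>
        nonvanishing_on_coord_subspaces f \<and>
        nondegenerate_at_infinity f \<and>
        (\<exists>\<sigma>\<in>{-1, 1}. \<exists>R>0. \<forall>x. norm x > R \<longrightarrow> \<sigma> * peval f x \<ge> 0))"
proof -
  have f: "f \<noteq> 0"
    using assms(2) by (auto simp: peval_def constant_on_def)
  let ?i = "stably_compact_zero_set f"
  let ?nv = "nonvanishing_on_coord_subspaces f"
  let ?ii = "\<forall>\<Delta>\<in>newton_boundary_infinity f. \<forall>x\<in>real_torus. peval (face_part f \<Delta>) x \<noteq> 0"
  let ?iii = "(\<forall>\<Delta>\<in>newton_boundary_infinity f. \<forall>x\<in>real_torus. peval (face_part f \<Delta>) x > 0) \<or>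
         (\<forall>\<Delta>\<in>newton_boundary_infinity f. \<forall>x\<in>real_torus. peval (face_part f \<Delta>) x < 0)"
  let ?iv = "\<exists>\<sigma>\<in>{-1, 1}. \<exists>c\<^sub>1>0. \<exists>c\<^sub>2>0. \<exists>R>0. \<forall>x. norm x > R \<longrightarrow>
           c\<^sub>1 * newton_majorant f x \<le> \<sigma> * peval f x \<and>
           \<sigma> * peval f x \<le> c\<^sub>2 * newton_majorant f x"
  \<comment> \<open>This weak sign condition follows from (iv) and is part of (v); it links both to
    the signs of the face parts.\<close>
  let ?sign = "\<exists>\<sigma>\<in>{-1, 1}. \<exists>R>0. \<forall>x. norm x > R \<longrightarrow> \<sigma> * peval f x \<ge> 0"
  have 1: "?nv" if ?i
    using that by (rule stably_compact_imp_nonvanishing)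
  have 2: "?ii" if ?i
    using stably_compact_imp_face_part_nonzero[OF assms(1) f that] by blast
  have 3: "?iv" if ?nv ?ii
    using that(2) by (intro face_parts_nonzero_imp_majorant_bounds[OF assms(1) f that(1)]) blast
  have 4: "?i" if ?nv ?iv
    using that(2) majorant_bound_imp_stably_compact[OF that(1)] by blast
  have 5: "?sign" if iv: "?iv"
  proof -
    obtain \<sigma> c R where s: "\<sigma> \<in> {-1, 1::real}" "c > 0" "R > 0"
      and le: "\<And>x. norm x > R \<Longrightarrow> c * newton_majorant f x \<le> \<sigma> * peval f x"
      using iv by blast
    have "0 \<le> \<sigma> * peval f x" if "norm x > R" for x
      by (rule order_trans[OF mult_nonneg_nonneg le[OF that]]) (use s newton_majorant_nonneg in auto)
    with s show ?thesis by blast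
  qed
  \<comment> \<open>The sign is inherited from \<open>f\<close> and is therefore common to all
    faces, as the uniform alternative in (iii) demands.\<close>
  have 6: "\<exists>\<sigma>\<in>{-1, 1}. \<forall>\<Delta>\<in>newton_boundary_infinity f. \<forall>x\<in>real_torus. 0 \<le> \<sigma> * peval (face_part f \<Delta>) x"
    if ?sign
    using that face_part_nonneg[OF f] by meson
  have 7: "?iii" if sgn: "?sign" and nz: "?ii"
  proof -
    obtain \<sigma> :: real where \<sigma>: "\<sigma> \<in> {-1, 1}"
      and nn: "\<And>\<Delta> x. \<Delta> \<in> newton_boundary_infinity f \<Longrightarrow> x \<in> real_torus \<Longrightarrow> 0 \<le> \<sigma> * peval (face_part f \<Delta>) x"
      using 6[OF sgn] by blast
    from \<sigma> consider "\<sigma> = 1" | "\<sigma> = -1" by auto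
    then show ?thesis
      using nn nz by cases (simp_all add: less_le)
  qed
  have 8: "nondegenerate_at_infinity f" if ?ii
    using that by (auto simp: nondegenerate_at_infinity_def)
  \<comment> \<open>A torus zero of a semidefinite face part is a minimum of \<sigma> times that
    part, so all partial derivatives vanish there and non-degeneracy fails.\<close>
  have 9: "?ii" if nondeg: "nondegenerate_at_infinity f" and sgn: "?sign"
  proof (intro ballI notI)
    fix \<Delta> x assume *: "\<Delta> \<in> newton_boundary_infinity f" "x \<in> real_torus" "peval (face_part f \<Delta>) x = 0"
    obtain \<sigma> :: real where "\<sigma> \<in> {-1, 1}"
      and nn: "\<And>y. y \<in> real_torus \<Longrightarrow> 0 \<le> \<sigma> * peval (face_part f \<Delta>) y"
      using 6[OF sgn] *(1) by blast
    then have "\<sigma> \<noteq> 0" by auto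
    from partial_deriv_zero_at_torus_minimum[OF nn this *(2,3)] nondeg * show False
      unfolding nondegenerate_at_infinity_def by blast
  qed
  have 10: "?ii" if ?iii
    using that by (metis less_irrefl)
  have A: "?i \<longleftrightarrow> ?nv \<and> ?ii" using 1 2 3 4 by argo
  have B: "?i \<longleftrightarrow> ?nv \<and> ?iii" using A 3 5 7 10 by argo
  have C: "?i \<longleftrightarrow> ?nv \<and> ?iv" using A 3 4 by argo
  have D: "?i \<longleftrightarrow> ?nv \<and> nondegenerate_at_infinity f \<and> ?sign" using A 3 5 8 9 by argo
  from A B C D show ?thesis by (intro conjI)
qed

end
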